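(* Let $G$ be a countable group and let $R$ be an ICC subgroup of $G$ such that (i) $R$ has non-factorizable regular character; (ii) for every $g\in G\setminus\{e\}$ there exists a sequence of distinct elements $\{g_i\}_{i\ge1}\subset C_R(g)$ such that $g_i^{-1}g_j\in R$ for all $i,j$, where $C_R(g)=\{rgr^{-1}: r\in R\}$. Then $G$ has non-factorizable regular character.
   Context: A group is ICC if every non-trivial element has an infinite conjugacy class. A character on a countable discrete group $G$ is a function $\phi: G\to\mathbb{C}$ that is positive definite, conjugation-invariant and normalized ($\phi(e)=1$). $\delta_e$ is the Dirac function at the identity. $G$ has non-factorizable regular character if for any characters $\phi,\psi$ on $G$ such that $\phi(s)\psi(s)=0$ for all $s\in G\setminus\{e\}$, one has $\phi\equiv\delta_e$ or $\psi\equiv\delta_e$. *)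

theory Defs
  imports "HOL-Algebra.Coset" "HOL-Library.Countable_Set" "HOL-Library.Nonpos_Ints"
begin

text \<open>
  A function on a group \<open>G\<close> is represented by a total function on the underlying type, of which
  only the values on \<open>carrier G\<close> matter. Accordingly, equality of functions on \<open>G\<close> is always
  pointwise equality on \<open>carrier G\<close>.
  A subgroup \<open>R\<close> of \<open>G\<close>, viewed as a group in its own right, is \<open>G\<lparr>carrier := R\<rparr>\<close>.
\<close>

definition conj_orbit :: "('a, 'b) monoid_scheme \<Rightarrow> 'a set \<Rightarrow> 'a \<Rightarrow> 'a set"
  where "conj_orbit G R g = {r \<otimes>\<^bsub>G\<^esub> g \<otimes>\<^bsub>G\<^esub> inv\<^bsub>G\<^esub> r | r. r \<in> R}"

definition icc :: "('a, 'b) monoid_scheme \<Rightarrow> bool"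
  where "icc G \<longleftrightarrow> (\<forall>g \<in> carrier G - {\<one>\<^bsub>G\<^esub>}. infinite (conj_orbit G (carrier G) g))"

text \<open>
  \<open>\<real>\<^sub>\<ge>\<^sub>0\<close> at type \<^typ>\<open>complex\<close> is the set of complex numbers that are real and nonnegative. The
  points \<open>x 0, \<dots>, x (n - 1)\<close> need not be distinct.
\<close>

definition positive_definite :: "('a, 'b) monoid_scheme \<Rightarrow> ('a \<Rightarrow> complex) \<Rightarrow> bool"
  where "positive_definite G \<phi> \<longleftrightarrow>
    (\<forall>(n::nat) (x::nat \<Rightarrow> 'a) (c::nat \<Rightarrow> complex). (\<forall>i<n. x i \<in> carrier G) \<longrightarrow>
      (\<Sum>i<n. \<Sum>j<n. cnj (c i) * c j * \<phi> (inv\<^bsub>G\<^esub> (x i) \<otimes>\<^bsub>G\<^esub> x j)) \<in> \<real>\<^sub>\<ge>\<^sub>0)"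

definition group_character :: "('a, 'b) monoid_scheme \<Rightarrow> ('a \<Rightarrow> complex) \<Rightarrow> bool"
  where "group_character G \<phi> \<longleftrightarrow>
    positive_definite G \<phi> \<and>
    (\<forall>g \<in> carrier G. \<forall>h \<in> carrier G. \<phi> (h \<otimes>\<^bsub>G\<^esub> g \<otimes>\<^bsub>G\<^esub> inv\<^bsub>G\<^esub> h) = \<phi> g) \<and>
    \<phi> \<one>\<^bsub>G\<^esub> = 1"

definition delta_one :: "('a, 'b) monoid_scheme \<Rightarrow> 'a \<Rightarrow> complex"
  where "delta_one G s = (if s = \<one>\<^bsub>G\<^esub> then 1 else 0)"

definition nonfactorizable_regular_character :: "('a, 'b) monoid_scheme \<Rightarrow> bool"
  where "nonfactorizable_regular_character G \<longleftrightarrow>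
    (\<forall>\<phi> \<psi>. group_character G \<phi> \<longrightarrow> group_character G \<psi> \<longrightarrow>
      (\<forall>s \<in> carrier G - {\<one>\<^bsub>G\<^esub>}. \<phi> s * \<psi> s = 0) \<longrightarrow>
      (\<forall>s \<in> carrier G. \<phi> s = delta_one G s) \<or> (\<forall>s \<in> carrier G. \<psi> s = delta_one G s))"

end

theory Submission
  imports Defs
begin

text \<open>
  On \<open>R\<close> one of the two characters, say \<open>\<phi>\<close>, is the Dirac function. For \<open>g \<noteq> e\<close>, the
  conjugates \<open>g\<^sub>i\<close> of \<open>g\<close> then have \<open>\<phi> (g\<^sub>i\<inverse> g\<^sub>j) = 0\<close> for \<open>i \<noteq> j\<close>, so in the GNS representation
  they give orthonormal vectors, each having inner product \<open>\<phi> g\<close> with the cyclic vector. Bessel's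
  inequality gives \<open>n \<bar>\<phi> g\<bar>\<^sup>2 \<le> 1\<close> for all \<open>n\<close>, hence \<open>\<phi> g = 0\<close>.
\<close>

text \<open>Apply positivity to the points \<open>\<one>\<close>, \<open>g\<close> with coefficients
  1, \<open>s\<close>. The form must be real: \<open>s = 1\<close> compares the imaginary parts of
  the two values, and \<open>s = \<i>\<close> compares their real parts.\<close>

lemma positive_definite_inv:
  assumes "group G" and pd: "positive_definite G \<phi>" and g: "g \<in> carrier G"
  shows "\<phi> (inv\<^bsub>G\<^esub> g) = cnj (\<phi> g)"
proof -
  interpret group G by fact
  define y where "y = case_nat \<one>\<^bsub>G\<^esub> (\<lambda>_. g)"
  have y: "\<forall>i<n. y i \<in> carrier G" for n
    using g by (auto simp: y_def split: nat.split)
  \<comment> \<open>The value at the identity need not be 1 here; that it is real lets it drop out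
    of the imaginary parts below.\<close>
  have one: "\<phi> \<one>\<^bsub>G\<^esub> \<in> \<real>\<^sub>\<ge>\<^sub>0"
    using pd[unfolded positive_definite_def, rule_format, of 1 y "\<lambda>_. 1"] y[of 1]
    by (simp add: y_def)
  have expand: "\<phi> \<one>\<^bsub>G\<^esub> + s * \<phi> g + (cnj s * \<phi> (inv\<^bsub>G\<^esub> g) + cnj s * s * \<phi> \<one>\<^bsub>G\<^esub>) \<in> \<real>\<^sub>\<ge>\<^sub>0" for s
    using pd[unfolded positive_definite_def, rule_format, of "Suc (Suc 0)" y "case_nat 1 (\<lambda>_. s)"]
      y[of "Suc (Suc 0)"] g
    by (simp add: y_def)
  have im: "Im (\<phi> \<one>\<^bsub>G\<^esub>) = 0"
    using one by (simp add: complex_nonneg_Reals_iff)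
  show ?thesis
    using expand[of 1] expand[of \<i>] im
    by (simp add: complex_nonneg_Reals_iff complex_eq_iff)
qed

text \<open>This is Bessel's inequality read off directly from positive definiteness, without
  building the GNS space.\<close>

lemma positive_definite_orthogonal_sequence:
  fixes x :: "nat \<Rightarrow> 'a"
  assumes "group G" and pd: "positive_definite G \<phi>" and one: "\<phi> \<one>\<^bsub>G\<^esub> = 1"
    and x: "\<And>i. x i \<in> carrier G" and const: "\<And>i. \<phi> (x i) = a"
    and orth: "\<And>i j. i \<noteq> j \<Longrightarrow> \<phi> (inv\<^bsub>G\<^esub> (x i) \<otimes>\<^bsub>G\<^esub> x j) = 0"
  shows "a = 0"
proof (rule ccontr)
  assume "a \<noteq> 0"
  interpret group G by fact
  define y where "y = case_nat \<one>\<^bsub>G\<^esub> x"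
  \<comment> \<open>These are the coefficients of the cyclic vector minus its projection onto the
    span of the first \<open>n\<close> orthonormal vectors: the inner product for \<open>x i\<close>
    is \<open>\<phi> (inv (x i)) = cnj a\<close>.\<close>
  define c where "c = case_nat 1 (\<lambda>_. - cnj a)"
  have bound: "real n * (cmod a)\<^sup>2 \<le> 1" for n
  proof -
    have gram: "\<phi> (inv\<^bsub>G\<^esub> (x i) \<otimes>\<^bsub>G\<^esub> x j) = (if i = j then 1 else 0)" for i j
      using orth one x by simp
    have inv: "\<phi> (inv\<^bsub>G\<^esub> (x i)) = cnj a" for i
      using positive_definite_inv[OF \<open>group G\<close> pd x] const by simp
    have "(\<Sum>i<Suc n. \<Sum>j<Suc n. cnj (c i) * c j * \<phi> (inv\<^bsub>G\<^esub> (y i) \<otimes>\<^bsub>G\<^esub> y j)) \<in> \<real>\<^sub>\<ge>\<^sub>0"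
    proof (rule pd[unfolded positive_definite_def, rule_format])
      show "y i \<in> carrier G" for i
        using x by (simp add: y_def split: nat.split)
    qed
    \<comment> \<open>Splitting off index 0 leaves 1 from the identity, two cross sums of
      \<open>- n * a * cnj a\<close> each, and \<open>+ n * a * cnj a\<close> from the
      diagonal.\<close>
    also have "(\<Sum>i<Suc n. \<Sum>j<Suc n. cnj (c i) * c j * \<phi> (inv\<^bsub>G\<^esub> (y i) \<otimes>\<^bsub>G\<^esub> y j))
        = 1 - of_nat n * (a * cnj a)"
      unfolding sum.lessThan_Suc_shift
      by (simp add: c_def y_def x const gram inv one sum.distrib sum_subtractf if_distrib
          cong: if_cong)
    finally have "0 \<le> Re (1 - of_nat n * (a * cnj a))"
      by (simp add: complex_nonneg_Reals_iff)
    then show ?thesis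
      by (simp only: cmod_power2) (simp add: power2_eq_square)
  qed
  have "0 < (cmod a)\<^sup>2"
    using \<open>a \<noteq> 0\<close> by simp
  then obtain n where "1 < real n * (cmod a)\<^sup>2"
    using reals_Archimedean3 by blast
  with bound show False
    by (meson not_le)
qed

lemma group_character_subgroup:
  assumes "group G" and R: "subgroup R G" and \<phi>: "group_character G \<phi>"
  shows "group_character (G\<lparr>carrier := R\<rparr>) \<phi>"
proof -
  interpret group G by fact
  note [simp] = m_inv_consistent[OF R] subgroup.mem_carrier[OF R]
  show ?thesis
    using \<phi> unfolding group_character_def positive_definite_def by simp
qed

text \<open>Conjugation invariance makes \<open>\<phi>\<close> constant on the sequence
  \<open>x\<close> in the orbit of \<open>s\<close>, while the quotients of distinct terms are
  nontrivial elements of \<open>R\<close>, where \<open>\<phi>\<close> vanishes.\<close>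

lemma group_character_eq_delta_one:
  fixes G :: "('a, 'b) monoid_scheme"
  assumes "group G" and R: "subgroup R G" and \<phi>: "group_character G \<phi>"
    and on_R: "\<And>s. s \<in> R \<Longrightarrow> \<phi> s = delta_one G s"
    and orbits: "\<And>g. g \<in> carrier G - {\<one>\<^bsub>G\<^esub>} \<Longrightarrow>
      \<exists>x :: nat \<Rightarrow> 'a. inj x \<and> (\<forall>i. x i \<in> conj_orbit G R g) \<and>
        (\<forall>i j. inv\<^bsub>G\<^esub> (x i) \<otimes>\<^bsub>G\<^esub> x j \<in> R)"
    and s: "s \<in> carrier G"
  shows "\<phi> s = delta_one G s"
proof (cases "s = \<one>\<^bsub>G\<^esub>")
  case True
  then show ?thesis
    using \<phi> by (simp add: group_character_def delta_one_def)
next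
  case False
  interpret group G by fact
  obtain x :: "nat \<Rightarrow> 'a" where x: "inj x" "\<And>i. x i \<in> conj_orbit G R s"
      "\<And>i j. inv\<^bsub>G\<^esub> (x i) \<otimes>\<^bsub>G\<^esub> x j \<in> R"
    using orbits[of s] s False by blast
  have conj: "x i \<in> carrier G \<and> \<phi> (x i) = \<phi> s" for i
    using x(2)[of i] \<phi> s subgroup.mem_carrier[OF R]
    by (auto simp: conj_orbit_def group_character_def)
  have "\<phi> (inv\<^bsub>G\<^esub> (x i) \<otimes>\<^bsub>G\<^esub> x j) = 0" if "i \<noteq> j" for i j
  proof -
    have "x i \<noteq> x j"
      using \<open>inj x\<close> that by (simp add: inj_eq)
    then have "inv\<^bsub>G\<^esub> (x i) \<otimes>\<^bsub>G\<^esub> x j \<noteq> \<one>\<^bsub>G\<^esub>"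
      using conj by (metis inv_closed inv_equality inv_inv)
    then show ?thesis
      using on_R[OF x(3)] by (simp add: delta_one_def)
  qed
  then have "\<phi> s = 0"
    using positive_definite_orthogonal_sequence[OF \<open>group G\<close>, of \<phi> x "\<phi> s"] \<phi> conj
    by (simp add: group_character_def)
  with False show ?thesis
    by (simp add: delta_one_def)
qed

theorem proposition3p12:
  fixes G :: "('a, 'b) monoid_scheme" and R :: "'a set"
  assumes "group G" and "countable (carrier G)"
    and "subgroup R G" and "icc (G\<lparr>carrier := R\<rparr>)"
    and "nonfactorizable_regular_character (G\<lparr>carrier := R\<rparr>)"
    and "\<And>g. g \<in> carrier G - {\<one>\<^bsub>G\<^esub>} \<Longrightarrow>
      \<exists>x :: nat \<Rightarrow> 'a. inj x \<and> (\<forall>i. x i \<in> conj_orbit G R g) \<and>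
        (\<forall>i j. inv\<^bsub>G\<^esub> (x i) \<otimes>\<^bsub>G\<^esub> x j \<in> R)"
  shows "nonfactorizable_regular_character G"
  unfolding nonfactorizable_regular_character_def
proof (intro allI impI)
  fix \<phi> \<psi>
  assume \<phi>: "group_character G \<phi>" and \<psi>: "group_character G \<psi>"
    and zero: "\<forall>s \<in> carrier G - {\<one>\<^bsub>G\<^esub>}. \<phi> s * \<psi> s = 0"
  have "\<forall>s \<in> R - {\<one>\<^bsub>G\<^esub>}. \<phi> s * \<psi> s = 0"
    using zero subgroup.subset[OF assms(3)] by blast
  \<comment> \<open>Both characters restrict to \<open>R\<close>, and \<open>R\<close> shares its
    identity with \<open>G\<close>, so the two Dirac functions agree.\<close>
  then have "(\<forall>s \<in> R. \<phi> s = delta_one G s) \<or> (\<forall>s \<in> R. \<psi> s = delta_one G s)"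
    using assms(5)[unfolded nonfactorizable_regular_character_def, rule_format, of \<phi> \<psi>]
      group_character_subgroup[OF assms(1,3)] \<phi> \<psi>
    by (simp add: delta_one_def)
  \<comment> \<open>Whichever character is the Dirac function on \<open>R\<close> is so on all of
    \<open>G\<close>.\<close>
  then show "(\<forall>s \<in> carrier G. \<phi> s = delta_one G s) \<or> (\<forall>s \<in> carrier G. \<psi> s = delta_one G s)"
    using group_character_eq_delta_one[OF assms(1,3) \<phi> _ assms(6)]
      group_character_eq_delta_one[OF assms(1,3) \<psi> _ assms(6)]
    by blast
qed

end
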